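(* Let $(X,\|\cdot\|)$ be a Banach space and let $f:X\to\mathbb{R}\cup\{+\infty\}$ be lower semicontinuous. Suppose that $\lambda$, $p$, $\epsilon$, $\epsilon_i$ $(i=1,2,\ldots)$ and $\delta_i$ $(i=0,1,\ldots)$ are positive numbers and $\epsilon_i\downarrow 0$ as $i\to\infty$. If $x_0\in X$ and $\delta_0$ satisfy $$f(x_0)\le\inf_X f+\epsilon\qquad\text{and}\qquad \delta_0\ge\frac{f(x_0)-\inf_X f}{\epsilon},$$ then there exist a point $\bar x\in X$ and a sequence $\{x_i\}_{i=1}^\infty\subset X$ such that $x_i\to\bar x$ as $i\to\infty$ and (i) $\|\bar x-x_0\|\le\lambda$; (ii) $\|\bar x-x_i\|\le\epsilon_i$ for $i=1,2,\ldots$; (iii) $\displaystyle f(\bar x)+\frac{\epsilon}{\lambda^p}\sum_{i=0}^\infty\delta_i\|\bar x-x_i\|^p\le f(x_0)$; (iv) $\displaystyle f(x)+\frac{\epsilon}{\lambda^p}\sum_{i=0}^\infty\delta_i\|x-x_i\|^p>f(\bar x)+\frac{\epsilon}{\lambda^p}\sum_{i=0}^\infty\delta_i\|\bar x-x_i\|^p$ for all $x\in X\setminus\{\bar x\}$.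
   Context: Apart from the displayed lower bound on $\delta_0$, no other restrictions are imposed on the positive numbers $\delta_i$; in particular, the series $\sum_{i=0}^\infty\delta_i$ may diverge, and the series on the left-hand side of (iv) can be divergent for some $x\in X$. *)

theory Defs
  imports "HOL-Analysis.Analysis"
begin

(* At an isolated point the right-hand side is \<infinity>, so the condition is vacuous there. *)
definition lower_semicontinuous :: "('a::topological_space \<Rightarrow> ereal) \<Rightarrow> bool" where
  "lower_semicontinuous f \<longleftrightarrow> (\<forall>x. f x \<le> Liminf (at x) f)"

(* The series is taken in the extended reals, so for \<delta> \<ge> 0 its terms are
   nonnegative and it equals \<infinity> exactly when it diverges. *)
definition perturbation ::
  "real \<Rightarrow> real \<Rightarrow> real \<Rightarrow> (nat \<Rightarrow> real) \<Rightarrow> (nat \<Rightarrow> 'a::real_normed_vector) \<Rightarrow> 'a \<Rightarrow> ereal" where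
  "perturbation eps lam p \<delta> xs x =
     ereal (eps / lam powr p) * (\<Sum>i. ereal (\<delta> i * norm (x - xs i) powr p))"

end

theory Submission
  imports Defs
begin

text \<open>
  The theorem is the Borwein--Preiss smooth variational principle in the form of Li and Shi. Put
  \<open>G n x = f x + (\<Sum>i<n. h i (x\<^sub>i) x)\<close>, where \<open>h i y x\<close> is the \<open>i\<close>-th penalty for leaving \<open>y\<close>.
  The points \<open>x\<^sub>n\<close> are chosen one after the other: the sublevel sets
  \<open>{x. G (j + 1) x \<le> G j (x\<^sub>j)}\<close>, \<open>j < n\<close>, intersect in a set \<open>T n\<close>, and for \<open>n \<ge> 1\<close> the point \<open>x\<^sub>n\<close>
  minimises \<open>G n\<close> over \<open>T n\<close> up to an error \<open>\<eta> n\<close>. A point of \<open>T (n + 1)\<close> pays the penalty \<open>h n (x\<^sub>n)\<close> but can gain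
  at most \<open>\<eta> n\<close> on \<open>G n (x\<^sub>n)\<close>, so the penalty is at most \<open>\<eta> n\<close> and the point lies close to
  \<open>x\<^sub>n\<close>. The \<open>T n\<close> are thus closed (by lower semicontinuity), nonempty (\<open>x\<^sub>n\<close> pays no penalty
  at step \<open>n\<close>), decreasing, and of diameter tending to zero, and they shrink to one point \<open>\<xi>\<close>.

  The values \<open>G n (x\<^sub>n)\<close> decrease from \<open>f x\<^sub>0\<close>, and each of them bounds all partial sums at \<open>\<xi>\<close>,
  hence the whole perturbed value at \<open>\<xi>\<close>. A point \<open>x \<noteq> \<xi>\<close> violates one of the inequalities that
  define the \<open>T n\<close>, say the one of index \<open>j\<close>. Then already the partial sum \<open>G (j + 1) x\<close> exceeds
  \<open>G j (x\<^sub>j)\<close>, which bounds the perturbed value at \<open>\<xi>\<close>. This makes the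
  minimum strict, even where the series at \<open>x\<close> diverges.

  The argument lives on a complete metric space, with continuous penalties that control the distance
  when they are small; this is \<open>perturbed_variational_principle\<close>. For the theorem the penalties are
  multiples of powers of the norm, and the bound on \<open>norm (\<xi> - x\<^sub>0)\<close> comes from the first term
  of the series alone: \<open>f x\<^sub>0\<close> exceeds the infimum by at most \<open>\<delta> 0 * eps\<close>, the penalty at distance
  \<open>lam\<close>.
\<close>

section \<open>Sublevel sets and approximate minimisers\<close>

text \<open>The limit inferior over punctured neighbourhoods does not see the point itself, but the
  strict inequality holds there anyway.\<close>

lemma lower_semicontinuous_eventually:
  assumes "lower_semicontinuous f" "b < f x"
  shows "eventually (\<lambda>y. b < f y) (nhds x)"
  using assms
  by (auto simp: lower_semicontinuous_def le_Liminf_iff eventually_nhds_conv_at)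

lemma closed_sublevel_lsc_add_continuous:
  fixes f :: "'a::topological_space \<Rightarrow> ereal"
  assumes "lower_semicontinuous f" "continuous_on UNIV g"
  shows "closed {x. f x + ereal (g x) \<le> C}"
proof -
  have "open (- {x. f x + ereal (g x) \<le> C})"
  proof (subst open_subopen, intro ballI)
    fix x assume "x \<in> - {x. f x + ereal (g x) \<le> C}"
    then have "C - ereal (g x) < f x"
      by (cases C; cases "f x") auto
    then obtain b where b: "C - ereal (g x) < ereal b" "ereal b < f x"
      using ereal_dense2 by metis
    have "eventually (\<lambda>y. ereal b < f y) (nhds x)"
      by (rule lower_semicontinuous_eventually[OF assms(1) b(2)])
    moreover have "eventually (\<lambda>y. C < ereal (b + g y)) (nhds x)"
    proof (rule order_tendstoD(1))
      have "(g \<longlongrightarrow> g x) (at x)" using assms(2) by (simp add: continuous_on_def)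
      then have "(g \<longlongrightarrow> g x) (nhds x)" by (simp only: tendsto_at_iff_tendsto_nhds)
      then show "((\<lambda>y. ereal (b + g y)) \<longlongrightarrow> ereal (b + g x)) (nhds x)"
        by (intro tendsto_intros)
      show "C < ereal (b + g x)" using b(1) by (cases C) auto
    qed
    ultimately have "eventually (\<lambda>y. y \<in> - {x. f x + ereal (g x) \<le> C}) (nhds x)"
    proof eventually_elim
      case (elim y)
      have "ereal (b + g y) \<le> f y + ereal (g y)"
        using add_right_mono[OF less_imp_le[OF elim(1)], of "ereal (g y)"] by simp
      then show ?case using elim(2) by simp
    qed
    then show "\<exists>U. open U \<and> x \<in> U \<and> U \<subseteq> - {x. f x + ereal (g x) \<le> C}"
      unfolding eventually_nhds by blast
  qed
  then show ?thesis by (simp add: closed_def)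
qed

lemma approximate_minimizer_exists:
  fixes g :: "'a \<Rightarrow> ereal" and \<eta> m :: real
  assumes "T \<noteq> {}" "\<And>y. ereal m \<le> g y" "\<eta> > 0"
  shows "\<exists>r\<in>T. \<forall>y\<in>T. g r \<le> g y + ereal \<eta>"
proof -
  have lower: "ereal m \<le> (INF y\<in>T. g y)"
    using assms(2) by (intro INF_greatest)
  show ?thesis
  proof (cases "(INF y\<in>T. g y)")
    case (real v)
    then have "(INF y\<in>T. g y) < ereal (v + \<eta>)" using assms(3) by simp
    then obtain r where r: "r \<in> T" "g r < ereal (v + \<eta>)"
      by (auto simp: INF_less_iff)
    have "g r \<le> g y + ereal \<eta>" if "y \<in> T" for y
    proof -
      have "ereal v \<le> g y" using that real by (metis INF_lower)
      then have "ereal v + ereal \<eta> \<le> g y + ereal \<eta>" by (rule add_right_mono)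
      then show ?thesis using r(2) by simp
    qed
    then show ?thesis using r(1) by blast
  next
    case PInf
    then have "g y = \<infinity>" if "y \<in> T" for y
      using that by (metis INF_lower ereal_infty_less_eq(1))
    then show ?thesis using assms(1) by fastforce
  next
    case MInf
    then show ?thesis using lower by simp
  qed
qed

lemma add_suminf_ereal_le:
  fixes c C :: ereal and a :: "nat \<Rightarrow> real"
  assumes "c \<noteq> -\<infinity>" "\<And>i. a i \<ge> 0" "\<And>n. c + ereal (\<Sum>i<n. a i) \<le> C"
  shows "c + (\<Sum>i. ereal (a i)) \<le> C"
proof -
  have "c + (\<Sum>i. ereal (a i)) = c + (SUP n. \<Sum>i<n. ereal (a i))"
    using assms(2) by (subst suminf_ereal_eq_SUP) auto
  also have "\<dots> = (SUP n. c + (\<Sum>i<n. ereal (a i)))"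
    using assms(1) by (subst SUP_ereal_add_right) auto
  also have "\<dots> \<le> C"
    using assms(3) by (intro SUP_least) simp
  finally show ?thesis .
qed

lemma sum_le_suminf_ereal:
  fixes a :: "nat \<Rightarrow> real"
  assumes "\<And>i. a i \<ge> 0"
  shows "ereal (\<Sum>i<n. a i) \<le> (\<Sum>i. ereal (a i))"
  using sum_le_suminf[of "\<lambda>i. ereal (a i)" "{..<n}"] assms by (simp add: summable_ereal_pos)

section \<open>Nested sublevel sets of partial sums\<close>

definition partial_potential ::
  "('a \<Rightarrow> ereal) \<Rightarrow> (nat \<Rightarrow> 'a \<Rightarrow> 'a \<Rightarrow> real) \<Rightarrow> (nat \<Rightarrow> 'a) \<Rightarrow> nat \<Rightarrow> 'a \<Rightarrow> ereal" where
  "partial_potential f h xs n x = f x + ereal (\<Sum>i<n. h i (xs i) x)"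

definition nested_sublevel ::
  "('a \<Rightarrow> ereal) \<Rightarrow> (nat \<Rightarrow> 'a \<Rightarrow> 'a \<Rightarrow> real) \<Rightarrow> (nat \<Rightarrow> 'a) \<Rightarrow> nat \<Rightarrow> 'a set" where
  "nested_sublevel f h xs n =
     {x. \<forall>j<n. partial_potential f h xs (Suc j) x \<le> partial_potential f h xs j (xs j)}"

lemma partial_potential_cong:
  assumes "\<And>i. i < n \<Longrightarrow> xs i = ys i"
  shows "partial_potential f h xs n = partial_potential f h ys n"
  using assms by (auto simp: partial_potential_def fun_eq_iff)

lemma nested_sublevel_cong:
  assumes "\<And>i. i < n \<Longrightarrow> xs i = ys i"
  shows "nested_sublevel f h xs n = nested_sublevel f h ys n"
proof -
  have "partial_potential f h xs (Suc j) = partial_potential f h ys (Suc j)"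
    "partial_potential f h xs j = partial_potential f h ys j" "xs j = ys j" if "j < n" for j
    using that assms by (auto intro!: partial_potential_cong)
  then show ?thesis by (auto simp: nested_sublevel_def)
qed

text \<open>Both the set to minimise over and the function to be minimised depend on all earlier points,
  so the choice is a well-founded recursion along \<open><\<close>. The set at step \<open>n + 1\<close> is nonempty because it
  contains the point of index \<open>n\<close>, which pays no penalty to itself.\<close>

lemma approximate_minimizing_sequence_exists:
  fixes f :: "'a \<Rightarrow> ereal" and \<eta> :: "nat \<Rightarrow> real" and m :: real
  assumes lower: "\<And>x. ereal m \<le> f x"
    and nonneg: "\<And>i y x. h i y x \<ge> 0" and diag: "\<And>i y. h i y y = 0"
    and \<eta>: "\<And>i. i \<ge> 1 \<Longrightarrow> \<eta> i > 0"
  obtains xs where "xs 0 = x0" "\<And>n. xs n \<in> nested_sublevel f h xs n"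
    "\<And>n y. n \<ge> 1 \<Longrightarrow> y \<in> nested_sublevel f h xs n \<Longrightarrow>
       partial_potential f h xs n (xs n) \<le> partial_potential f h xs n y + ereal (\<eta> n)"
proof -
  define P where "P xs n r \<longleftrightarrow> (if n = 0 then r = x0 else
      r \<in> nested_sublevel f h xs n \<and> (\<forall>y\<in>nested_sublevel f h xs n.
        partial_potential f h xs n r \<le> partial_potential f h xs n y + ereal (\<eta> n)))"
    for xs and n :: nat and r
  have "\<exists>xs. \<forall>n. P xs n (xs n)"
  proof (rule dependent_wf_choice[OF wf_less])
    fix xs ys :: "nat \<Rightarrow> 'a" and n r
    assume "\<And>z. (z, n) \<in> {(x, y). x < y} \<Longrightarrow> xs z = ys z"
    then have "\<And>i. i < n \<Longrightarrow> xs i = ys i" by simp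
    from nested_sublevel_cong[of n xs ys, OF this] partial_potential_cong[of n xs ys, OF this]
    show "P xs n r = P ys n r" by (simp add: P_def)
  next
    fix n :: nat and xs :: "nat \<Rightarrow> 'a"
    assume prev: "\<And>y. (y, n) \<in> {(x, y). x < y} \<Longrightarrow> P xs y (xs y)"
    show "\<exists>r. P xs n r"
    proof (cases n)
      case 0
      then show ?thesis by (simp add: P_def)
    next
      case (Suc k)
      have "xs k \<in> nested_sublevel f h xs k"
        using prev[of k] Suc by (cases "k = 0") (auto simp: P_def nested_sublevel_def)
      then have "xs k \<in> nested_sublevel f h xs n"
        using Suc diag by (auto simp: nested_sublevel_def less_Suc_eq partial_potential_def)
      moreover have "ereal m \<le> partial_potential f h xs n y" for y
        using add_mono[OF lower[of y], of 0 "ereal (\<Sum>i<n. h i (xs i) y)"] nonneg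
        by (auto simp: partial_potential_def intro!: sum_nonneg)
      ultimately show ?thesis
        using approximate_minimizer_exists[of "nested_sublevel f h xs n" m
            "partial_potential f h xs n" "\<eta> n"] \<eta>[of n] Suc
        by (auto simp: P_def)
    qed
  qed
  then obtain xs where xs: "\<And>n. P xs n (xs n)" by blast
  show thesis
  proof (rule that[of xs])
    show "xs 0 = x0" using xs[of 0] by (simp add: P_def)
    show "xs n \<in> nested_sublevel f h xs n" for n
      using xs[of n] by (cases "n = 0") (auto simp: P_def nested_sublevel_def)
    show "partial_potential f h xs n (xs n) \<le> partial_potential f h xs n y + ereal (\<eta> n)"
      if "n \<ge> 1" "y \<in> nested_sublevel f h xs n" for n y
      using xs[of n] that by (auto simp: P_def)
  qed
qed

section \<open>The perturbed variational principle\<close>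

lemma Cauchy_if_tails_near:
  fixes xs :: "nat \<Rightarrow> 'a::metric_space"
  assumes "\<epsilon> \<longlonglongrightarrow> 0" "\<And>i k. 1 \<le> i \<Longrightarrow> i < k \<Longrightarrow> dist (xs k) (xs i) \<le> \<epsilon> i"
  shows "Cauchy xs"
proof (rule metric_CauchyI)
  fix e :: real assume "e > 0"
  then have "eventually (\<lambda>i. \<epsilon> i < e / 2 \<and> 1 \<le> i) sequentially"
    by (intro eventually_conj order_tendstoD(2)[OF assms(1)] eventually_ge_at_top) auto
  then obtain N where N: "\<epsilon> N < e / 2" "1 \<le> N"
    using eventually_happens trivial_limit_sequentially by blast
  have near: "dist (xs k) (xs N) < e / 2" if "k \<ge> N" for k
    using assms(2)[OF N(2), of k] N(1) that \<open>e > 0\<close> by (cases "k = N") auto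
  have "dist (xs k) (xs l) < e" if "k \<ge> N" "l \<ge> N" for k l
    using dist_triangle_half_l near that by blast
  then show "\<exists>M. \<forall>m\<ge>M. \<forall>n\<ge>M. dist (xs m) (xs n) < e" by blast
qed

text \<open>The variational principle for penalties that vanish at their base point and, when small,
  force proximity to it. The error admitted in the \<open>i\<close>-th minimisation has to match the penalty:
  \<open>h i y x \<le> \<eta> i\<close> must imply \<open>dist x y \<le> \<epsilon> i\<close>. The index \<open>0\<close> is exempt because \<open>x\<^sub>0\<close> is prescribed,
  with no relation to an error \<open>\<eta> 0\<close>.\<close>

theorem perturbed_variational_principle:
  fixes f :: "'a::complete_space \<Rightarrow> ereal" and h :: "nat \<Rightarrow> 'a \<Rightarrow> 'a \<Rightarrow> real"
    and \<eta> \<epsilon> :: "nat \<Rightarrow> real" and m :: real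
  assumes lsc: "lower_semicontinuous f"
    and lower: "\<And>x. ereal m \<le> f x" and finite0: "f x0 < \<infinity>"
    and nonneg: "\<And>i y x. h i y x \<ge> 0" and diag: "\<And>i y. h i y y = 0"
    and cont: "\<And>i y. continuous_on UNIV (h i y)"
    and \<eta>: "\<And>i. i \<ge> 1 \<Longrightarrow> \<eta> i > 0"
    and near: "\<And>i y x. i \<ge> 1 \<Longrightarrow> h i y x \<le> \<eta> i \<Longrightarrow> dist x y \<le> \<epsilon> i"
    and \<epsilon>: "\<epsilon> \<longlonglongrightarrow> 0"
  obtains \<xi> xs where "xs 0 = x0" "xs \<longlonglongrightarrow> \<xi>" "\<And>i. i \<ge> 1 \<Longrightarrow> dist \<xi> (xs i) \<le> \<epsilon> i"
    "f \<xi> + (\<Sum>i. ereal (h i (xs i) \<xi>)) \<le> f x0"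
    "\<And>x. x \<noteq> \<xi> \<Longrightarrow>
       f \<xi> + (\<Sum>i. ereal (h i (xs i) \<xi>)) < f x + (\<Sum>i. ereal (h i (xs i) x))"
proof -
  obtain xs where xs0: "xs 0 = x0"
    and xs_mem: "\<And>n. xs n \<in> nested_sublevel f h xs n"
    and xs_min: "\<And>n y. n \<ge> 1 \<Longrightarrow> y \<in> nested_sublevel f h xs n \<Longrightarrow>
       partial_potential f h xs n (xs n) \<le> partial_potential f h xs n y + ereal (\<eta> n)"
    using approximate_minimizing_sequence_exists[of m f h \<eta> x0, OF lower nonneg diag \<eta>] by blast
  define G where "G = partial_potential f h xs"
  define T where "T = nested_sublevel f h xs"
  note G_def' = G_def partial_potential_def
  have T_iff: "x \<in> T n \<longleftrightarrow> (\<forall>j<n. G (Suc j) x \<le> G j (xs j))" for x n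
    by (simp add: T_def nested_sublevel_def G_def)
  have T_anti: "T k \<subseteq> T n" if "n \<le> k" for n k
    using that by (auto simp: T_iff)
  have G_Suc: "G (Suc n) x = G n x + ereal (h n (xs n) x)" for n x
    by (simp add: G_def' add.assoc)
  have G_mono: "G n x \<le> G k x" if "n \<le> k" for n k x
    using that nonneg by (auto simp: G_def' intro!: add_left_mono sum_mono2)
  have G_lower: "ereal m \<le> G n x" for n x
    using G_mono[of 0 n x] lower[of x] by (auto simp: G_def' intro: order_trans)
  have G_diag_anti: "G k (xs k) \<le> G n (xs n)" if "n \<le> k" for n k
  proof -
    have "G (Suc n) (xs (Suc n)) \<le> G n (xs n)" for n
      using xs_mem[of "Suc n"] by (auto simp: T_iff simp flip: T_def)
    then have "decseq (\<lambda>n. G n (xs n))" by (rule decseq_SucI)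
    then show ?thesis using that by (rule decseqD)
  qed
  have G_diag_finite: "G n (xs n) < \<infinity>" for n
  proof -
    have "G n (xs n) \<le> G 0 (xs 0)" by (rule G_diag_anti) simp
    also have "\<dots> < \<infinity>" using finite0 by (simp add: G_def' xs0)
    finally show ?thesis .
  qed
  have closed_T: "closed (T n)" for n
  proof -
    have "T n = (\<Inter>j<n. {x. f x + ereal (\<Sum>i<Suc j. h i (xs i) x) \<le> G j (xs j)})"
      by (auto simp: T_iff G_def')
    also have "closed \<dots>"
      by (intro closed_INT ballI closed_sublevel_lsc_add_continuous lsc continuous_on_sum cont)
    finally show ?thesis .
  qed
  have T_near: "dist x (xs i) \<le> \<epsilon> i" if "i \<ge> 1" "x \<in> T (Suc i)" for i x
  proof (rule near[OF \<open>i \<ge> 1\<close>])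
    have "x \<in> T i" using T_anti[of i "Suc i"] that(2) by auto
    then have "G i (xs i) \<le> G i x + ereal (\<eta> i)"
      using xs_min that(1) by (simp add: T_def G_def)
    moreover have gain: "G i x + ereal (h i (xs i) x) \<le> G i (xs i)"
      using that(2) by (simp add: T_iff flip: G_Suc)
    ultimately have "G i x + ereal (h i (xs i) x) \<le> G i x + ereal (\<eta> i)"
      by (rule order_trans[rotated])
    moreover have "G i x \<noteq> \<infinity>" "G i x \<noteq> -\<infinity>"
      using gain G_diag_finite[of i] G_lower[of i x] by auto
    ultimately show "h i (xs i) x \<le> \<eta> i"
      by (cases "G i x") auto
  qed
  have "Cauchy xs"
  proof (rule Cauchy_if_tails_near[OF \<epsilon>])
    fix i k :: nat assume "1 \<le> i" "i < k"
    then have "xs k \<in> T (Suc i)" using xs_mem[of k] T_anti[of "Suc i" k] by (auto simp: T_def)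
    then show "dist (xs k) (xs i) \<le> \<epsilon> i" by (rule T_near[OF \<open>1 \<le> i\<close>])
  qed
  then obtain \<xi> where lim: "xs \<longlonglongrightarrow> \<xi>"
    by (auto simp: Cauchy_convergent_iff convergent_def)
  have \<xi>_mem: "\<xi> \<in> T n" for n
  proof (rule Lim_in_closed_set[OF closed_T _ _ lim])
    show "eventually (\<lambda>k. xs k \<in> T n) sequentially"
      using xs_mem T_anti by (auto simp: T_def eventually_sequentially intro!: exI[of _ n])
  qed simp
  have not_neg_inf: "f x \<noteq> -\<infinity>" for x using lower[of x] by auto
  have \<xi>_bound: "f \<xi> + (\<Sum>i. ereal (h i (xs i) \<xi>)) \<le> G j (xs j)" for j
  proof (rule add_suminf_ereal_le[OF not_neg_inf nonneg])
    fix n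
    have "G n \<xi> \<le> G (Suc (max n j)) \<xi>" by (rule G_mono) simp
    also have "\<dots> \<le> G (max n j) (xs (max n j))"
      using \<xi>_mem[of "Suc (max n j)"] by (auto simp: T_iff)
    also have "\<dots> \<le> G j (xs j)" by (rule G_diag_anti) simp
    finally show "f \<xi> + ereal (\<Sum>i<n. h i (xs i) \<xi>) \<le> G j (xs j)" by (simp add: G_def')
  qed
  show thesis
  proof (rule that[of xs \<xi>])
    show "dist \<xi> (xs i) \<le> \<epsilon> i" if "i \<ge> 1" for i
      using T_near[OF that \<xi>_mem] .
    show "f \<xi> + (\<Sum>i. ereal (h i (xs i) \<xi>)) \<le> f x0"
      using \<xi>_bound[of 0] by (simp add: G_def' xs0)
    fix x assume "x \<noteq> \<xi>"
    have "\<exists>n. x \<notin> T n"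
    proof (rule ccontr)
      assume "\<not> (\<exists>n. x \<notin> T n)"
      then have "dist (xs i) x \<le> \<epsilon> i" if "i \<ge> 1" for i
        using T_near[OF that, of x] by (simp add: dist_commute)
      then have "eventually (\<lambda>i. dist (xs i) x \<le> \<epsilon> i) sequentially"
        by (auto simp: eventually_sequentially)
      then have "(\<lambda>i. dist (xs i) x) \<longlonglongrightarrow> 0"
        by (intro tendsto_sandwich[OF _ _ tendsto_const \<epsilon>]) auto
      then have "xs \<longlonglongrightarrow> x" by (simp add: tendsto_dist_iff[of xs x])
      then show False using lim \<open>x \<noteq> \<xi>\<close> LIMSEQ_unique by blast
    qed
    then obtain j where "G j (xs j) < G (Suc j) x" by (auto simp: T_iff not_le)
    also have "G (Suc j) x \<le> f x + (\<Sum>i. ereal (h i (xs i) x))"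
      unfolding G_def' by (intro add_left_mono sum_le_suminf_ereal nonneg)
    finally show "f \<xi> + (\<Sum>i. ereal (h i (xs i) \<xi>)) < f x + (\<Sum>i. ereal (h i (xs i) x))"
      using \<xi>_bound[of j] by (rule le_less_trans[rotated])
  qed (fact xs0 lim)+
qed

section \<open>Powers of the norm as penalties\<close>

lemma powr_le_cancel_right:
  fixes a b p :: real
  assumes "p > 0" "b \<ge> 0" "a powr p \<le> b powr p"
  shows "a \<le> b"
  using assms powr_less_mono2[of p b a] by force

lemma perturbation_eq_suminf:
  assumes "eps > 0" "\<And>i. \<delta> i > 0"
  shows "perturbation eps lam p \<delta> xs x =
    (\<Sum>i. ereal (eps / lam powr p * (\<delta> i * norm (x - xs i) powr p)))"
proof -
  have "eps / lam powr p \<ge> 0" using assms(1) by simp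
  then show ?thesis
    unfolding perturbation_def using assms(2)
    by (subst suminf_cmult_ereal[symmetric]) (auto simp: less_imp_le)
qed

theorem corollary9:
  fixes f :: "'a::banach \<Rightarrow> ereal"
    and lam p eps :: real
    and epsi \<delta> :: "nat \<Rightarrow> real"
    and x0 :: 'a
  assumes "\<forall>x. f x \<noteq> -\<infinity>"
    and "lower_semicontinuous f"
    and "lam > 0" and "p > 0" and "eps > 0"
    and "\<forall>i\<ge>1. epsi i > 0"
    and "\<forall>i. \<delta> i > 0"
    and "antimono_on {1..} epsi"
    and "epsi \<longlonglongrightarrow> 0"
    and "f x0 \<le> (INF x. f x) + ereal eps"
    and "ereal (\<delta> 0) \<ge> (f x0 - (INF x. f x)) / ereal eps"
  shows "\<exists>(xbar::'a) (xs :: nat \<Rightarrow> 'a).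
    xs 0 = x0 \<and> xs \<longlonglongrightarrow> xbar \<and>
    norm (xbar - x0) \<le> lam \<and>
    (\<forall>i\<ge>1. norm (xbar - xs i) \<le> epsi i) \<and>
    f xbar + perturbation eps lam p \<delta> xs xbar \<le> f x0 \<and>
    (\<forall>x. x \<noteq> xbar \<longrightarrow>
       f x + perturbation eps lam p \<delta> xs x > f xbar + perturbation eps lam p \<delta> xs xbar)"
proof -
  have \<delta>: "\<delta> i > 0" for i using assms(7) by blast
  define c where "c = eps / lam powr p"
  have c: "c > 0" using assms(3,5) by (simp add: c_def)
  \<comment> \<open>An infimum \<open>\<infinity>\<close> would make the quotient that bounds \<open>\<delta> 0\<close> infinite, since
    \<open>\<infinity> - \<infinity> = \<infinity>\<close> in the extended reals; an infimum \<open>-\<infinity>\<close> would force \<open>f x0 = -\<infinity>\<close>.\<close>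
  obtain m where m: "(INF x. f x) = ereal m"
  proof (cases "(INF x. f x)")
    case PInf
    then have "f x0 = \<infinity>" by (metis INF_lower UNIV_I ereal_infty_less_eq(1))
    then show thesis using PInf assms(5,11) by simp
  next
    case MInf
    then show thesis using assms(1,10) by simp
  qed
  have lower: "ereal m \<le> f x" for x using m by (metis INF_lower UNIV_I)
  obtain v where v: "f x0 = ereal v"
    using assms(1,10) m by (cases "f x0") auto
  have v_bound: "v - m \<le> \<delta> 0 * eps"
    using assms(5,11) by (simp add: m v field_simps)
  define h where "h i y x = c * (\<delta> i * norm (x - y) powr p)" for i and y x :: 'a
  have h_nonneg: "h i y x \<ge> 0" for i y x
    using c less_imp_le[OF \<delta>[of i]] by (simp add: h_def)
  have h_near: "dist x y \<le> r" if "r \<ge> 0" "h i y x \<le> c * (\<delta> i * r powr p)" for i y x r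
  proof -
    have "norm (x - y) powr p \<le> r powr p"
      using that(2) c \<delta>[of i] by (simp add: h_def)
    then show ?thesis
      using powr_le_cancel_right[OF assms(4) that(1)] by (simp add: dist_norm)
  qed
  have h_cont: "continuous_on UNIV (h i y)" for i y
    unfolding h_def using assms(4) by (intro continuous_intros continuous_on_powr') auto
  obtain \<xi> xs where *: "xs 0 = x0" "xs \<longlonglongrightarrow> \<xi>" "\<And>i. i \<ge> 1 \<Longrightarrow> dist \<xi> (xs i) \<le> epsi i"
    and val: "f \<xi> + (\<Sum>i. ereal (h i (xs i) \<xi>)) \<le> f x0"
    and strict: "\<And>x. x \<noteq> \<xi> \<Longrightarrow>
       f \<xi> + (\<Sum>i. ereal (h i (xs i) \<xi>)) < f x + (\<Sum>i. ereal (h i (xs i) x))"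
  proof (rule perturbed_variational_principle[where f = f and m = m and ?x0.0 = x0 and h = h
        and \<eta> = "\<lambda>i. c * (\<delta> i * epsi i powr p)" and \<epsilon> = epsi])
    show "0 < c * (\<delta> i * epsi i powr p)" if "i \<ge> 1" for i
    proof -
      have "epsi i > 0" using assms(6) that by blast
      then show ?thesis using c \<delta>[of i] by simp
    qed
    show "dist x y \<le> epsi i" if "i \<ge> 1" "h i y x \<le> c * (\<delta> i * epsi i powr p)" for i y x
      using h_near[OF _ that(2)] assms(6) that(1) by (simp add: less_imp_le)
  qed (use assms(2,4,9) lower h_nonneg h_cont v in \<open>auto simp: h_def\<close>)
  have "norm (\<xi> - x0) \<le> lam"
  proof -
    have "ereal m + ereal (h 0 (xs 0) \<xi>) \<le> f \<xi> + (\<Sum>i. ereal (h i (xs i) \<xi>))"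
      using sum_le_suminf_ereal[of "\<lambda>i. h i (xs i) \<xi>" 1] h_nonneg lower
      by (intro add_mono) simp_all
    also have "\<dots> \<le> ereal v" using val v by simp
    finally have "h 0 x0 \<xi> \<le> c * (\<delta> 0 * lam powr p)"
      using v_bound assms(3) by (simp add: c_def *(1) mult.commute)
    then show ?thesis using h_near[of lam] assms(3) by (simp add: dist_norm)
  qed
  moreover have "perturbation eps lam p \<delta> xs x = (\<Sum>i. ereal (h i (xs i) x))" for x
    by (simp add: perturbation_eq_suminf[OF assms(5) \<delta>] h_def c_def)
  ultimately show ?thesis
    using * val strict by (intro exI[of _ \<xi>] exI[of _ xs]) (auto simp: dist_norm)
qed

end
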